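(* Consider the Gaussian channel described in the context, with channel power gains $g_1^p,g_2^p,g_s^p,g_1^s,g_2^s,g_s^s>0$, powers $P_1,P_2,P_s>0$ and noise variance $N_0>0$. For $\lambda\in[0,1]$ let $Z=Z_\lambda$ be the element of $\mathcal{G}(P_1,P_2,P_s)$ with $U$ of variance $\lambda P_s$ and $W$ of variance $(1-\lambda)P_s$. Then $\mathcal{R}^o(Z)=\mathcal{R}^o_g$ if and only if $\lambda=0$ and $$I(Y_s;W)\le I(Y_p;W|X_1X_2),$$ the last inequality being equivalent (at $\lambda=0$) to $$g_s^sN_0\le g_s^p\,(g_1^sP_1+g_2^sP_2+N_0).$$
   Context: Gaussian channel: real inputs $x_1,x_2,x_s$ and outputs $$y_p=\sqrt{g_1^p}\,x_1+\sqrt{g_2^p}\,x_2+\sqrt{g_s^p}\,x_s+n_p,\qquad y_s=\sqrt{g_1^s}\,x_1+\sqrt{g_2^s}\,x_2+\sqrt{g_s^s}\,x_s+n_s,$$ where $n_p,n_s$ are independent zero-mean Gaussian noises of variance $N_0$, independent of the inputs. $\mathcal{G}(P_1,P_2,P_s)$ is the set of $Z=UWX_1X_2X_sY_pY_s$ (time-sharing variable $Q$ constant, hence omitted) where $X_1,X_2,U,W$ are independent zero-mean Gaussian random variables, $X_s=U+W$, $\mathrm{Var}(X_1)=P_1$, $\mathrm{Var}(X_2)=P_2$, $\mathrm{Var}(X_s)=P_s$, and $Y_p,Y_s$ are the corresponding channel outputs. Thus the elements are parametrized by $\lambda\in[0,1]$ via $\mathrm{Var}(U)=\lambda P_s$,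 $\mathrm{Var}(W)=(1-\lambda)P_s$ (a zero-variance Gaussian being the constant $0$). $\mathcal{R}^o(Z)$ is the set of all pairs $(R_s,R_p)=(S+T,\,R_1+R_2)$ with $(R_1,R_2,S,T)$ nonnegative reals satisfying $$R_1\le I(Y_p;X_1|WX_2),\quad R_2\le I(Y_p;X_2|WX_1),\quad T\le I(Y_p;W|X_1X_2),\quad R_1+R_2\le I(Y_p;X_1X_2|W),$$ $$T+R_1\le I(Y_p;WX_1|X_2),\quad T+R_2\le I(Y_p;WX_2|X_1),\quad T+R_1+R_2\le I(Y_p;WX_1X_2),$$ $$S\le I(Y_s;U|W),\quad T\le I(Y_s;W|U),\quad S+T\le I(Y_s;UW).$$ $\mathcal{R}^o_g$ is the closure of $\bigcup_{Z\in\mathcal{G}(P_1,P_2,P_s)}\mathcal{R}^o(Z)$. *)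

theory Defs
  imports "HOL-Probability.Probability"
begin

text \<open>
  A tuple \<open>Z = U W X1 X2 Xs Yp Ys\<close> of real random variables enters the mutual informations only
  through its joint law, so \<open>Z\<close> is represented by that law: a Borel probability measure on
  \<open>rv \<Rightarrow> real\<close>, on which the random variable named \<open>v\<close> is the coordinate map \<open>\<lambda>\<omega>. \<omega> v\<close>.
\<close>

datatype rv = U | W | X1 | X2 | Xs | Yp | Ys

type_synonym law = "(rv \<Rightarrow> real) measure"

record channel =
  g1p :: real
  g2p :: real
  gsp :: real
  g1s :: real
  g2s :: real
  gss :: real
  N0 :: real

definition valid_channel :: "channel \<Rightarrow> bool" where
  "valid_channel c \<longleftrightarrow> g1p c > 0 \<and> g2p c > 0 \<and> gsp c > 0 \<and>
     g1s c > 0 \<and> g2s c > 0 \<and> gss c > 0 \<and> N0 c > 0"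

text \<open>The noises, recovered from inputs and outputs through the channel equations.\<close>

definition noise_p :: "channel \<Rightarrow> (rv \<Rightarrow> real) \<Rightarrow> real" where
  "noise_p c \<omega> = \<omega> Yp - (sqrt (g1p c) * \<omega> X1 + sqrt (g2p c) * \<omega> X2 + sqrt (gsp c) * \<omega> Xs)"

definition noise_s :: "channel \<Rightarrow> (rv \<Rightarrow> real) \<Rightarrow> real" where
  "noise_s c \<omega> = \<omega> Ys - (sqrt (g1s c) * \<omega> X1 + sqrt (g2s c) * \<omega> X2 + sqrt (gss c) * \<omega> Xs)"

definition zero_mean_gaussian :: "'a measure \<Rightarrow> real \<Rightarrow> ('a \<Rightarrow> real) \<Rightarrow> bool" where
  "zero_mean_gaussian M v X \<longleftrightarrow>
     (if v = 0 then X \<in> borel_measurable M \<and> (AE \<omega> in M. X \<omega> = 0)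
      else v > 0 \<and> distributed M lborel X (normal_density 0 (sqrt v)))"

text \<open>
  The noises are independent of the auxiliary variables \<open>U\<close>, \<open>W\<close> as well as of the channel inputs.
\<close>

definition gaussian_laws :: "channel \<Rightarrow> real \<Rightarrow> real \<Rightarrow> real \<Rightarrow> law set" where
  "gaussian_laws c P1 P2 Ps = {Z.
     prob_space Z \<and> sets Z = sets (\<Pi>\<^sub>M v\<in>UNIV. borel) \<and>
     prob_space.indep_vars Z (\<lambda>_. borel)
       (\<lambda>i. [\<lambda>\<omega>. \<omega> X1, \<lambda>\<omega>. \<omega> X2, \<lambda>\<omega>. \<omega> U, \<lambda>\<omega>. \<omega> W, noise_p c, noise_s c] ! i) {..<6} \<and>
     zero_mean_gaussian Z P1 (\<lambda>\<omega>. \<omega> X1) \<and>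
     zero_mean_gaussian Z P2 (\<lambda>\<omega>. \<omega> X2) \<and>
     (\<exists>u. zero_mean_gaussian Z u (\<lambda>\<omega>. \<omega> U)) \<and>
     (\<exists>w. zero_mean_gaussian Z w (\<lambda>\<omega>. \<omega> W)) \<and>
     (AE \<omega> in Z. \<omega> Xs = \<omega> U + \<omega> W) \<and>
     prob_space.variance Z (\<lambda>\<omega>. \<omega> Xs) = Ps \<and>
     zero_mean_gaussian Z (N0 c) (noise_p c) \<and>
     zero_mean_gaussian Z (N0 c) (noise_s c)}"

text \<open>
  \<open>mi b Z y A\<close> is \<open>I(y; A)\<close> and \<open>cmi b Z y A C\<close> is \<open>I(y; A | C)\<close>, with logarithms to base \<open>b\<close>.
  The library defines conditional mutual information by the chain rule, as
  \<open>I(y; A, C) - I(y; C)\<close>. When \<open>y\<close> is an output, the noise makes its joint law with any inputs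
  absolutely continuous with respect to the product of the marginals, so both terms are the usual
  finite quantities even if \<open>U\<close> or \<open>W\<close> is constant.
\<close>

definition mi :: "real \<Rightarrow> law \<Rightarrow> rv \<Rightarrow> rv set \<Rightarrow> real" where
  "mi b Z y A = prob_space.mutual_information Z b borel (\<Pi>\<^sub>M v\<in>A. borel)
     (\<lambda>\<omega>. \<omega> y) (\<lambda>\<omega>. restrict \<omega> A)"

definition cmi :: "real \<Rightarrow> law \<Rightarrow> rv \<Rightarrow> rv set \<Rightarrow> rv set \<Rightarrow> real" where
  "cmi b Z y A C = prob_space.conditional_mutual_information Z b
     borel (\<Pi>\<^sub>M v\<in>A. borel) (\<Pi>\<^sub>M v\<in>C. borel)
     (\<lambda>\<omega>. \<omega> y) (\<lambda>\<omega>. restrict \<omega> A) (\<lambda>\<omega>. restrict \<omega> C)"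

text \<open>Rate pairs are ordered \<open>(R\<^sub>s, R\<^sub>p)\<close>.\<close>

definition rate_region :: "real \<Rightarrow> law \<Rightarrow> (real \<times> real) set" where
  "rate_region b Z = {(S + T, R1 + R2) | S T R1 R2.
     0 \<le> R1 \<and> 0 \<le> R2 \<and> 0 \<le> S \<and> 0 \<le> T \<and>
     R1 \<le> cmi b Z Yp {X1} {W, X2} \<and>
     R2 \<le> cmi b Z Yp {X2} {W, X1} \<and>
     T \<le> cmi b Z Yp {W} {X1, X2} \<and>
     R1 + R2 \<le> cmi b Z Yp {X1, X2} {W} \<and>
     T + R1 \<le> cmi b Z Yp {W, X1} {X2} \<and>
     T + R2 \<le> cmi b Z Yp {W, X2} {X1} \<and>
     T + R1 + R2 \<le> mi b Z Yp {W, X1, X2} \<and>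
     S \<le> cmi b Z Ys {U} {W} \<and>
     T \<le> cmi b Z Ys {W} {U} \<and>
     S + T \<le> mi b Z Ys {U, W}}"

definition gaussian_rate_region :: "real \<Rightarrow> channel \<Rightarrow> real \<Rightarrow> real \<Rightarrow> real \<Rightarrow> (real \<times> real) set" where
  "gaussian_rate_region b c P1 P2 Ps = closure (\<Union>Z\<in>gaussian_laws c P1 P2 Ps. rate_region b Z)"

end

theory Submission
  imports Defs
begin

text \<open>
  Each output is a sum of independent zero-mean Gaussians, so every information quantity is half the
  logarithm of a ratio of residual variances: if \<open>Y = f(G) + V\<close> with \<open>V\<close> independent of \<open>G\<close>, the joint
  law of \<open>(Y, G)\<close> has density \<open>p\<^sub>V(y - f(g)) / p\<^sub>Y(y)\<close> with respect to the product of the marginals,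
  which also covers degenerate \<open>G\<close>.

  Without private message (\<open>\<lambda> = 0\<close>) the region reduces to bounds on \<open>R\<^sub>s\<close>, \<open>R\<^sub>p\<close> and \<open>R\<^sub>s + R\<^sub>p\<close>. If
  \<open>g\<^sub>s\<^sup>s N\<^sub>0 \<le> g\<^sub>s\<^sup>p (g\<^sub>1\<^sup>s P\<^sub>1 + g\<^sub>2\<^sup>s P\<^sub>2 + N\<^sub>0)\<close>, power moved to \<open>U\<close> gains less at \<open>Ys\<close> than it costs at \<open>Yp\<close>, so
  this region contains all others. If the inequality fails, \<open>\<lambda> = 1\<close> attains a larger \<open>R\<^sub>s\<close> than
  \<open>\<lambda> = 0\<close>, and for \<open>\<lambda> > 0\<close> the maximal \<open>R\<^sub>p\<close> is strictly below that of \<open>\<lambda> = 0\<close>. The laws for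
  \<open>\<lambda> = 0\<close> and \<open>\<lambda> = 1\<close> are images of the given one, with \<open>U + W\<close> merged into one of its two summands.
\<close>

subsection \<open>Information in additive Gaussian noise\<close>

lemma zero_mean_gaussian_cong_AE:
  assumes "zero_mean_gaussian M v X" and [measurable]: "Y \<in> borel_measurable M"
    and "AE \<omega> in M. X \<omega> = Y \<omega>"
  shows "zero_mean_gaussian M v Y"
proof (cases "v = 0")
  case True
  with assms show ?thesis
    by (auto simp: zero_mean_gaussian_def elim!: AE_mp)
next
  case False
  with assms(1) have D: "v > 0" "distributed M lborel X (normal_density 0 (sqrt v))"
    by (auto simp: zero_mean_gaussian_def)
  have "distr M lborel X = distr M lborel Y"
    using D(2) assms(3) by (intro distr_cong_AE) (auto simp: distributed_def)
  with D show ?thesis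
    by (auto simp: zero_mean_gaussian_def distributed_def)
qed

lemma zero_mean_gaussian_measurable [measurable_dest]:
  "zero_mean_gaussian M v X \<Longrightarrow> X \<in> borel_measurable M"
  by (auto simp: zero_mean_gaussian_def distributed_def split: if_splits)

lemma zero_mean_gaussian_nonneg: "zero_mean_gaussian M v X \<Longrightarrow> 0 \<le> v"
  by (auto simp: zero_mean_gaussian_def split: if_splits)

context prob_space
begin

lemma zero_mean_gaussian_scale:
  assumes X: "zero_mean_gaussian M v X"
  shows "zero_mean_gaussian M (a\<^sup>2 * v) (\<lambda>\<omega>. a * X \<omega>)"
proof -
  note [measurable] = zero_mean_gaussian_measurable[OF X]
  show ?thesis
  proof (cases "a = 0 \<or> v = 0")
    case True
    have "AE \<omega> in M. a * X \<omega> = 0"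
    proof (cases "a = 0")
      case False
      with True X have "AE \<omega> in M. X \<omega> = 0"
        by (auto simp: zero_mean_gaussian_def)
      then show ?thesis by (auto elim!: AE_mp)
    qed auto
    with True show ?thesis by (auto simp: zero_mean_gaussian_def)
  next
    case False
    with X have D: "v > 0" "distributed M lborel X (normal_density 0 (sqrt v))"
      by (auto simp: zero_mean_gaussian_def)
    show ?thesis
      using normal_density_affine[OF D(2), of a 0] D(1) False
      by (auto simp: zero_mean_gaussian_def real_sqrt_mult)
  qed
qed

text \<open>A summand of zero variance vanishes almost surely, so the sum is almost surely the other
  summand; only the case of two positive variances is a convolution of normal densities.\<close>

lemma zero_mean_gaussian_add:
  assumes X: "zero_mean_gaussian M v X" and Y: "zero_mean_gaussian M w Y"
    and indep: "indep_var borel X borel Y"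
  shows "zero_mean_gaussian M (v + w) (\<lambda>\<omega>. X \<omega> + Y \<omega>)"
proof -
  note [measurable] = zero_mean_gaussian_measurable[OF X] zero_mean_gaussian_measurable[OF Y]
  consider "v = 0" | "w = 0" | "v > 0" "w > 0"
    using zero_mean_gaussian_nonneg[OF X] zero_mean_gaussian_nonneg[OF Y] by linarith
  then show ?thesis
  proof cases
    case 1
    with X have "AE \<omega> in M. Y \<omega> = X \<omega> + Y \<omega>"
      by (auto simp: zero_mean_gaussian_def)
    from zero_mean_gaussian_cong_AE[OF Y _ this] 1 show ?thesis
      by simp
  next
    case 2
    with Y have "AE \<omega> in M. X \<omega> = X \<omega> + Y \<omega>"
      by (auto simp: zero_mean_gaussian_def)
    from zero_mean_gaussian_cong_AE[OF X _ this] 2 show ?thesis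
      by simp
  next
    case 3
    then show ?thesis
      using add_indep_normal[OF indep, of "sqrt v" "sqrt w" 0 0] X Y
      by (auto simp: zero_mean_gaussian_def)
  qed
qed

lemma zero_mean_gaussian_sum:
  assumes "finite I" "indep_vars (\<lambda>_. borel) X I"
    and "\<And>i. i \<in> I \<Longrightarrow> zero_mean_gaussian M (v i) (X i)"
  shows "zero_mean_gaussian M (\<Sum>i\<in>I. v i) (\<lambda>\<omega>. \<Sum>i\<in>I. X i \<omega>)"
  using assms
proof (induction I rule: finite_induct)
  case empty
  then show ?case by (simp add: zero_mean_gaussian_def)
next
  case (insert i I)
  have "zero_mean_gaussian M (v i + (\<Sum>i\<in>I. v i)) (\<lambda>\<omega>. X i \<omega> + (\<Sum>i\<in>I. X i \<omega>))"
    using insert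
    by (intro zero_mean_gaussian_add indep_vars_sum insert.IH)
       (auto intro: indep_vars_subset)
  then show ?case
    using insert.hyps by simp
qed

lemma zero_mean_gaussian_second_moment:
  assumes X: "zero_mean_gaussian M v X"
  shows "integrable M (\<lambda>\<omega>. (X \<omega>)\<^sup>2)" "expectation (\<lambda>\<omega>. (X \<omega>)\<^sup>2) = v"
    and "expectation X = 0"
proof -
  note [measurable] = zero_mean_gaussian_measurable[OF X]
  have "integrable M (\<lambda>\<omega>. (X \<omega>)\<^sup>2) \<and> expectation (\<lambda>\<omega>. (X \<omega>)\<^sup>2) = v \<and> expectation X = 0"
  proof (cases "v = 0")
    case True
    with X have ae: "AE \<omega> in M. X \<omega> = 0"
      by (auto simp: zero_mean_gaussian_def)
    have "integrable M (\<lambda>\<omega>. (X \<omega>)\<^sup>2) \<longleftrightarrow> integrable M (\<lambda>\<omega>. 0::real)"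
      using ae by (intro integrable_cong_AE) (auto elim!: AE_mp)
    moreover have "expectation (\<lambda>\<omega>. (X \<omega>)\<^sup>2) = expectation (\<lambda>\<omega>. 0)"
      using ae by (intro integral_cong_AE) (auto elim!: AE_mp)
    moreover have "expectation X = expectation (\<lambda>\<omega>. 0)"
      using ae by (intro integral_cong_AE) (auto elim!: AE_mp)
    ultimately show ?thesis using True by simp
  next
    case False
    with X have D: "v > 0" "distributed M lborel X (normal_density 0 (sqrt v))"
      by (auto simp: zero_mean_gaussian_def)
    have "expectation X = 0"
      using normal_distributed_expectation[OF _ D(2)] D(1) by simp
    moreover have "variance X = v"
      using normal_distributed_variance[OF _ D(2)] D(1) by simp
    moreover have "integrable M (\<lambda>\<omega>. (X \<omega>)\<^sup>2)"
      using distributed_integrable[OF D(2), of "\<lambda>x. x\<^sup>2"]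
        integrable_normal_moment[of "sqrt v" 0 2] D(1) by simp
    ultimately show ?thesis by simp
  qed
  then show "integrable M (\<lambda>\<omega>. (X \<omega>)\<^sup>2)" "expectation (\<lambda>\<omega>. (X \<omega>)\<^sup>2) = v"
    "expectation X = 0" by auto
qed

lemma zero_mean_gaussian_variance:
  "zero_mean_gaussian M v X \<Longrightarrow> variance X = v"
  by (simp add: zero_mean_gaussian_second_moment)

section \<open>Mutual information across additive Gaussian noise\<close>

text \<open>This is the pointwise information density. Its quadratic part has mean zero once
  \<open>x\<close> and \<open>y\<close> are centred Gaussians of variances \<open>v\<close> and
  \<open>w\<close>, so the constant is the mutual information.\<close>

lemma log_normal_density_ratio:
  assumes "b > 1" "v > 0" "w > 0"
  shows "log b (normal_density 0 (sqrt v) x / normal_density 0 (sqrt w) y) =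
    log b (w / v) / 2 + (y\<^sup>2 / (2 * w) - x\<^sup>2 / (2 * v)) / ln b"
proof -
  have ln: "ln (normal_density 0 (sqrt t) z) = - ln (2 * pi) / 2 - ln t / 2 - z\<^sup>2 / (2 * t)"
    if "t > 0" for t z :: real
    using that by (simp add: normal_density_def ln_mult ln_div ln_sqrt add_divide_distrib diff_divide_distrib)
  have pos: "normal_density 0 (sqrt t) z > 0" if "t > 0" for t z :: real
    using that by (intro normal_density_pos) simp
  have "ln (normal_density 0 (sqrt v) x / normal_density 0 (sqrt w) y) =
      ln (w / v) / 2 + (y\<^sup>2 / (2 * w) - x\<^sup>2 / (2 * v))"
    using assms pos[of v x] pos[of w y] by (simp add: ln ln_div)
  then show ?thesis
    by (simp add: log_def add_divide_distrib)
qed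

text \<open>Given \<open>G = a\<close>, the variable \<open>Y\<close> is \<open>V\<close> translated
  by \<open>f a\<close>. The densities are compared for each fixed \<open>a\<close>, and the result
  is integrated over the law of \<open>G\<close>.\<close>

lemma distr_additive_gaussian:
  assumes G [measurable]: "G \<in> measurable M T"
    and indep: "distr M borel V \<Otimes>\<^sub>M distr M T G = distr M (borel \<Otimes>\<^sub>M T) (\<lambda>\<omega>. (V \<omega>, G \<omega>))"
    and f [measurable]: "f \<in> borel_measurable T"
    and V: "zero_mean_gaussian M v V"
    and Y: "zero_mean_gaussian M w (\<lambda>\<omega>. f (G \<omega>) + V \<omega>)"
    and pos: "v > 0" "w > 0"
  defines "r \<equiv> \<lambda>p. normal_density 0 (sqrt v) (fst p - f (snd p)) / normal_density 0 (sqrt w) (fst p)"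
  shows "distr M (borel \<Otimes>\<^sub>M T) (\<lambda>\<omega>. (f (G \<omega>) + V \<omega>, G \<omega>)) =
    density (distr M borel (\<lambda>\<omega>. f (G \<omega>) + V \<omega>) \<Otimes>\<^sub>M distr M T G) r"
    (is "_ = density (distr M borel ?Y \<Otimes>\<^sub>M _) r")
proof (rule measure_eqI)
  note [measurable] = zero_mean_gaussian_measurable[OF V] zero_mean_gaussian_measurable[OF Y]
  show "sets (distr M (borel \<Otimes>\<^sub>M T) (\<lambda>\<omega>. (?Y \<omega>, G \<omega>))) =
    sets (density (distr M borel ?Y \<Otimes>\<^sub>M distr M T G) r)"
    by simp
  interpret V: prob_space "distr M borel V" by (rule prob_space_distr) simp
  interpret G: prob_space "distr M T G" by (rule prob_space_distr) simp
  interpret Y: prob_space "distr M borel ?Y" by (rule prob_space_distr) simp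
  interpret VG: pair_sigma_finite "distr M borel V" "distr M T G" ..
  interpret YG: pair_sigma_finite "distr M borel ?Y" "distr M T G" ..
  have dV: "distr M borel V = density lborel (normal_density 0 (sqrt v))"
    and dY: "distr M borel ?Y = density lborel (normal_density 0 (sqrt w))"
    using V Y pos by (auto simp: zero_mean_gaussian_def distributed_def cong: distr_cong)
  have r_meas [measurable]: "r \<in> borel_measurable (borel \<Otimes>\<^sub>M T)"
    unfolding r_def by measurable
  fix E assume "E \<in> sets (distr M (borel \<Otimes>\<^sub>M T) (\<lambda>\<omega>. (?Y \<omega>, G \<omega>)))"
  then have E [measurable]: "E \<in> sets (borel \<Otimes>\<^sub>M T)" by simp
  \<comment> \<open>The density of \<open>Y\<close> cancels the denominator of \<open>r\<close>,
    which leaves the density of \<open>V\<close> at \<open>y - f a\<close>; translation invariance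
    of Lebesgue measure does the rest.\<close>
  have shift: "(\<integral>\<^sup>+y. ennreal (r (y, a)) * indicator E (y, a) \<partial>distr M borel ?Y) =
      (\<integral>\<^sup>+x. indicator E (f a + x, a) \<partial>distr M borel V)" if a [measurable]: "a \<in> space T" for a
  proof -
    have "(\<integral>\<^sup>+y. ennreal (r (y, a)) * indicator E (y, a) \<partial>distr M borel ?Y) =
        (\<integral>\<^sup>+y. ennreal (normal_density 0 (sqrt w) y) * (ennreal (r (y, a)) * indicator E (y, a)) \<partial>lborel)"
      unfolding dY by (subst nn_integral_density) measurable
    also have "\<dots> = (\<integral>\<^sup>+y. ennreal (normal_density 0 (sqrt v) (y - f a)) * indicator E (y, a) \<partial>lborel)"
    proof (rule nn_integral_cong)
      fix y
      have "normal_density 0 (sqrt w) y > 0"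
        using pos by (intro normal_density_pos) simp
      then have "ennreal (normal_density 0 (sqrt w) y) * ennreal (r (y, a)) =
          ennreal (normal_density 0 (sqrt v) (y - f a))"
        by (subst ennreal_mult[symmetric]) (auto simp: r_def)
      then show "ennreal (normal_density 0 (sqrt w) y) * (ennreal (r (y, a)) * indicator E (y, a)) =
          ennreal (normal_density 0 (sqrt v) (y - f a)) * indicator E (y, a)"
        by (simp add: mult.assoc[symmetric])
    qed
    also have "\<dots> = (\<integral>\<^sup>+x. ennreal (normal_density 0 (sqrt v) x) * indicator E (f a + x, a) \<partial>lborel)"
      by (subst nn_integral_real_affine[where c=1 and t="f a"]) auto
    also have "\<dots> = (\<integral>\<^sup>+x. indicator E (f a + x, a) \<partial>distr M borel V)"
      unfolding dV by (subst nn_integral_density) measurable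
    finally show ?thesis .
  qed
  have "emeasure (distr M (borel \<Otimes>\<^sub>M T) (\<lambda>\<omega>. (?Y \<omega>, G \<omega>))) E =
      (\<integral>\<^sup>+p. indicator E p \<partial>distr M (borel \<Otimes>\<^sub>M T) (\<lambda>\<omega>. (?Y \<omega>, G \<omega>)))"
    by simp
  also have "\<dots> = (\<integral>\<^sup>+\<omega>. indicator E (?Y \<omega>, G \<omega>) \<partial>M)"
    by (subst nn_integral_distr) auto
  also have "\<dots> = (\<integral>\<^sup>+p. indicator E (f (snd p) + fst p, snd p) \<partial>distr M (borel \<Otimes>\<^sub>M T) (\<lambda>\<omega>. (V \<omega>, G \<omega>)))"
    by (subst nn_integral_distr) auto
  also have "\<dots> = (\<integral>\<^sup>+p. indicator E (f (snd p) + fst p, snd p) \<partial>(distr M borel V \<Otimes>\<^sub>M distr M T G))"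
    by (simp add: indep)
  also have "\<dots> = (\<integral>\<^sup>+a. (\<integral>\<^sup>+x. indicator E (f a + x, a) \<partial>distr M borel V) \<partial>distr M T G)"
    by (subst VG.nn_integral_snd[symmetric]) auto
  also have "\<dots> = (\<integral>\<^sup>+a. (\<integral>\<^sup>+y. ennreal (r (y, a)) * indicator E (y, a) \<partial>distr M borel ?Y) \<partial>distr M T G)"
    by (intro nn_integral_cong) (simp add: shift)
  also have "\<dots> = (\<integral>\<^sup>+p. ennreal (r p) * indicator E p \<partial>(distr M borel ?Y \<Otimes>\<^sub>M distr M T G))"
    by (subst YG.nn_integral_snd[symmetric]) auto
  also have "\<dots> = emeasure (density (distr M borel ?Y \<Otimes>\<^sub>M distr M T G) r) E"
    by (subst emeasure_density) auto
  finally show "emeasure (distr M (borel \<Otimes>\<^sub>M T) (\<lambda>\<omega>. (?Y \<omega>, G \<omega>))) E =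
    emeasure (density (distr M borel ?Y \<Otimes>\<^sub>M distr M T G) r) E" .
qed

text \<open>The divergence of the joint law from the product is the mean of \<open>log b r\<close>
  under the joint law. Pulled back to \<open>M\<close>, this needs only second moments of
  \<open>V\<close> and \<open>Y\<close>.\<close>

lemma mutual_information_additive_gaussian:
  assumes b: "b > 1"
    and G [measurable]: "G \<in> measurable M T"
    and indep: "distr M borel V \<Otimes>\<^sub>M distr M T G = distr M (borel \<Otimes>\<^sub>M T) (\<lambda>\<omega>. (V \<omega>, G \<omega>))"
    and f [measurable]: "f \<in> borel_measurable T"
    and V: "zero_mean_gaussian M v V"
    and Y: "zero_mean_gaussian M w (\<lambda>\<omega>. f (G \<omega>) + V \<omega>)"
    and pos: "v > 0" "w > 0"
  shows "mutual_information b borel T (\<lambda>\<omega>. f (G \<omega>) + V \<omega>) G = log b (w / v) / 2"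
    (is "mutual_information b borel T ?Y G = _")
proof -
  note [measurable] = zero_mean_gaussian_measurable[OF V] zero_mean_gaussian_measurable[OF Y]
  interpret G: prob_space "distr M T G" by (rule prob_space_distr) simp
  interpret Y: prob_space "distr M borel ?Y" by (rule prob_space_distr) simp
  interpret YG: pair_sigma_finite "distr M borel ?Y" "distr M T G" ..
  define P where "P = distr M borel ?Y \<Otimes>\<^sub>M distr M T G"
  define J where "J = distr M (borel \<Otimes>\<^sub>M T) (\<lambda>\<omega>. (?Y \<omega>, G \<omega>))"
  define r where "r = (\<lambda>p. normal_density 0 (sqrt v) (fst p - f (snd p)) / normal_density 0 (sqrt w) (fst p))"
  have J: "J = density P r"
    unfolding J_def P_def r_def by (rule distr_additive_gaussian[OF G indep f V Y pos])
  have setsP [measurable_cong]: "sets P = sets (borel \<Otimes>\<^sub>M T)"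
    by (auto simp: P_def intro!: sets_pair_measure_cong)
  have [measurable]: "r \<in> borel_measurable (borel \<Otimes>\<^sub>M T)"
    unfolding r_def by measurable
  have r0: "0 \<le> r p" for p
    by (simp add: r_def)
  have "mutual_information b borel T ?Y G = KL_divergence b P (density P r)"
    unfolding mutual_information_def J[symmetric] by (simp add: P_def J_def)
  also have "\<dots> = (\<integral>p. r p * log b (r p) \<partial>P)"
    unfolding P_def using b r0 by (intro YG.P.KL_density) auto
  also have "\<dots> = (\<integral>p. log b (r p) \<partial>J)"
    unfolding J using r0 by (subst integral_real_density) auto
  also have "\<dots> = expectation (\<lambda>\<omega>. log b (r (?Y \<omega>, G \<omega>)))"
    unfolding J_def by (subst integral_distr) auto
  also have "\<dots> = expectation (\<lambda>\<omega>. log b (w / v) / 2 + ((?Y \<omega>)\<^sup>2 / (2 * w) - (V \<omega>)\<^sup>2 / (2 * v)) / ln b)"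
    using log_normal_density_ratio[OF b pos] by (simp add: r_def)
  \<comment> \<open>The means of \<open>Y^2 / (2 * w)\<close> and \<open>V^2 / (2 * v)\<close> are
    both 1/2 and cancel.\<close>
  also have "\<dots> = log b (w / v) / 2"
    using zero_mean_gaussian_second_moment[OF V] zero_mean_gaussian_second_moment[OF Y] pos
    by (simp add: prob_space)
  finally show ?thesis .
qed

end

subsection \<open>Laws of the Gaussian channel\<close>

text \<open>The family is grouped into the blocks \<open>{f i}\<close>, disjoint by injectivity, and
  the single coordinate of each block is read off.\<close>

lemma (in prob_space) indep_vars_reindex:
  assumes indep: "indep_vars M' X (f ` I)" and inj: "inj_on f I"
  shows "indep_vars (\<lambda>i. M' (f i)) (\<lambda>i. X (f i)) I"
proof -
  have "indep_vars (\<lambda>i. PiM {f i} M') (\<lambda>i \<omega>. restrict (\<lambda>j. X j \<omega>) {f i}) I"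
    using inj by (intro indep_vars_restrict[OF indep]) (auto simp: disjoint_family_on_def inj_on_def)
  from indep_vars_compose2[OF this, of "\<lambda>i x. x (f i)" "\<lambda>i. M' (f i)"] show ?thesis
    by simp
qed

text \<open>Independence says that the joint law is the product of the marginals, and these laws are
  the same for \<open>X i\<close> under the image measure as for \<open>X i\<close> composed with
  \<open>h\<close>.\<close>

lemma (in prob_space) indep_vars_distr:
  assumes h [measurable]: "h \<in> measurable M N"
    and X [measurable]: "\<And>i. i \<in> I \<Longrightarrow> X i \<in> measurable N (M' i)" and "I \<noteq> {}"
    and indep: "indep_vars M' (\<lambda>i \<omega>. X i (h \<omega>)) I"
  shows "prob_space.indep_vars (distr M N h) M' X I"
proof -
  interpret N: prob_space "distr M N h" by (rule prob_space_distr) (rule h)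
  have "distr M (PiM I M') (\<lambda>\<omega>. \<lambda>i\<in>I. X i (h \<omega>)) = (\<Pi>\<^sub>M i\<in>I. distr M (M' i) (\<lambda>\<omega>. X i (h \<omega>)))"
    using indep \<open>I \<noteq> {}\<close>
    by (subst indep_vars_iff_distr_eq_PiM'[symmetric]) (auto simp: indep_vars_def)
  moreover have "distr (distr M N h) (PiM I M') (\<lambda>\<omega>. \<lambda>i\<in>I. X i \<omega>) =
      distr M (PiM I M') (\<lambda>\<omega>. \<lambda>i\<in>I. X i (h \<omega>))"
    by (subst distr_distr) (auto simp: comp_def intro!: measurable_restrict)
  moreover have "(\<Pi>\<^sub>M i\<in>I. distr (distr M N h) (M' i) (X i)) = (\<Pi>\<^sub>M i\<in>I. distr M (M' i) (\<lambda>\<omega>. X i (h \<omega>)))"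
    by (intro PiM_cong) (auto simp: distr_distr comp_def)
  ultimately show ?thesis
    using \<open>I \<noteq> {}\<close> by (subst N.indep_vars_iff_distr_eq_PiM') auto
qed

lemma zero_mean_gaussian_distr:
  assumes [measurable]: "h \<in> measurable M N" "X \<in> borel_measurable N"
  shows "zero_mean_gaussian (distr M N h) v X \<longleftrightarrow> zero_mean_gaussian M v (\<lambda>\<omega>. X (h \<omega>))"
proof -
  have [measurable]: "{x \<in> space N. X x = 0} \<in> sets N" by measurable
  show ?thesis
    by (auto simp: zero_mean_gaussian_def distributed_def distr_distr comp_def AE_distr_iff)
qed

section \<open>The six independent sources of a channel law\<close>

text \<open>\<open>Xs\<close> is left out because it is almost surely \<open>U + W\<close>.\<close>

definition sources :: "rv set" where
  "sources = {U, W, X1, X2, Yp, Ys}"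

text \<open>The noises are indexed by the outputs they belong to.\<close>

definition source :: "channel \<Rightarrow> rv \<Rightarrow> (rv \<Rightarrow> real) \<Rightarrow> real" where
  "source c v = (case v of Yp \<Rightarrow> noise_p c | Ys \<Rightarrow> noise_s c | _ \<Rightarrow> (\<lambda>\<omega>. \<omega> v))"

definition source_var :: "channel \<Rightarrow> real \<Rightarrow> real \<Rightarrow> real \<Rightarrow> real \<Rightarrow> rv \<Rightarrow> real" where
  "source_var c P1 P2 u w v =
     (case v of U \<Rightarrow> u | W \<Rightarrow> w | X1 \<Rightarrow> P1 | X2 \<Rightarrow> P2 | _ \<Rightarrow> N0 c)"

text \<open>\<open>gain c y v\<close> is the squared coefficient of source \<open>v\<close> in the output \<open>y\<close>, with \<open>Xs\<close> expanded to \<open>U + W\<close>.\<close>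

definition gain :: "channel \<Rightarrow> rv \<Rightarrow> rv \<Rightarrow> real" where
  "gain c y v =
     (if v = y then 1
      else if y = Yp then (case v of X1 \<Rightarrow> g1p c | X2 \<Rightarrow> g2p c | U \<Rightarrow> gsp c | W \<Rightarrow> gsp c | _ \<Rightarrow> 0)
      else (case v of X1 \<Rightarrow> g1s c | X2 \<Rightarrow> g2s c | U \<Rightarrow> gss c | W \<Rightarrow> gss c | _ \<Rightarrow> 0))"

text \<open>A working form of membership in \<open>gaussian_laws\<close>: the variances of
  \<open>U\<close> and \<open>W\<close> become parameters, independence is indexed by names instead
  of list positions, and the constraint on the power of \<open>Xs\<close> is split off.\<close>

definition gaussian_law :: "channel \<Rightarrow> real \<Rightarrow> real \<Rightarrow> real \<Rightarrow> real \<Rightarrow> law \<Rightarrow> bool" where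
  "gaussian_law c P1 P2 u w Z \<longleftrightarrow>
     prob_space Z \<and> sets Z = sets (\<Pi>\<^sub>M v\<in>UNIV. borel) \<and>
     prob_space.indep_vars Z (\<lambda>_. borel) (source c) sources \<and>
     (\<forall>v\<in>sources. zero_mean_gaussian Z (source_var c P1 P2 u w v) (source c v)) \<and>
     (AE \<omega> in Z. \<omega> Xs = \<omega> U + \<omega> W)"

lemma finite_sources [simp]: "finite sources"
  by (simp add: sources_def)

lemma source_measurable [measurable]: "source c v \<in> borel_measurable (\<Pi>\<^sub>M v\<in>UNIV. borel)"
  by (cases v) (simp_all add: source_def noise_p_def[abs_def] noise_s_def[abs_def])

text \<open>Reindexing along \<open>f\<close> gives one implication, reindexing along its inverse
  \<open>g\<close> the other.\<close>

lemma indep_vars_source_iff: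
  assumes "prob_space Z"
  shows "prob_space.indep_vars Z (\<lambda>_. borel)
       (\<lambda>i. [\<lambda>\<omega>. \<omega> X1, \<lambda>\<omega>. \<omega> X2, \<lambda>\<omega>. \<omega> U, \<lambda>\<omega>. \<omega> W, noise_p c, noise_s c] ! i) {..<6} \<longleftrightarrow>
     prob_space.indep_vars Z (\<lambda>_. borel) (source c) sources"
    (is "prob_space.indep_vars Z _ ?X _ \<longleftrightarrow> _")
proof -
  interpret prob_space Z by fact
  define f where "f i = [X1, X2, U, W, Yp, Ys] ! i" for i
  define g where "g v = (case v of X1 \<Rightarrow> 0 | X2 \<Rightarrow> 1 | U \<Rightarrow> 2 | W \<Rightarrow> 3 | Yp \<Rightarrow> 4 | _ \<Rightarrow> (5::nat))" for v
  have six: "{..<6::nat} = {0, 1, 2, 3, 4, 5}" by auto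
  have f: "inj_on f {..<6}" "f ` {..<6} = sources"
    by (auto simp: six f_def sources_def)
  have g: "inj_on g sources" "g ` sources = {..<6}"
    by (auto simp: six g_def sources_def)
  have "?X i = source c (f i)" if "i \<in> {..<6}" for i
    using that by (auto simp: six f_def source_def)
  then have 1: "indep_vars (\<lambda>_. borel) ?X {..<6} \<longleftrightarrow> indep_vars (\<lambda>_. borel) (\<lambda>i. source c (f i)) {..<6}"
    by (intro indep_vars_cong) auto
  have "?X (g v) = source c v" if "v \<in> sources" for v
    using that by (auto simp: sources_def g_def source_def)
  then have 2: "indep_vars (\<lambda>_. borel) (\<lambda>v. ?X (g v)) sources \<longleftrightarrow> indep_vars (\<lambda>_. borel) (source c) sources"
    by (intro indep_vars_cong) auto
  show ?thesis
    using 1 2 indep_vars_reindex[of "\<lambda>_. borel" "source c" f "{..<6}"]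
      indep_vars_reindex[of "\<lambda>_. borel" ?X g sources] f g by auto
qed

lemma gaussian_law_sum_input:
  assumes Z: "gaussian_law c P1 P2 u w Z"
  shows "zero_mean_gaussian Z (u + w) (\<lambda>\<omega>. \<omega> U + \<omega> W)"
proof -
  interpret prob_space Z using Z by (simp add: gaussian_law_def)
  have I: "indep_vars (\<lambda>_. borel) (source c) {U, W}"
    using Z by (auto simp: gaussian_law_def sources_def intro: indep_vars_subset)
  have "zero_mean_gaussian Z (\<Sum>v\<in>{U, W}. source_var c P1 P2 u w v) (\<lambda>\<omega>. \<Sum>v\<in>{U, W}. source c v \<omega>)"
    using Z by (intro zero_mean_gaussian_sum I) (auto simp: gaussian_law_def sources_def)
  then show ?thesis
    by (simp add: source_var_def source_def)
qed

lemma gaussian_law_variance_Xs: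
  assumes Z: "gaussian_law c P1 P2 u w Z"
  shows "prob_space.variance Z (\<lambda>\<omega>. \<omega> Xs) = u + w"
proof -
  interpret prob_space Z using Z by (simp add: gaussian_law_def)
  have sets [measurable_cong]: "sets Z = sets (\<Pi>\<^sub>M v\<in>UNIV. borel)"
    using Z by (simp add: gaussian_law_def)
  have "AE \<omega> in Z. \<omega> U + \<omega> W = \<omega> Xs"
    using Z by (auto simp: gaussian_law_def)
  then have "zero_mean_gaussian Z (u + w) (\<lambda>\<omega>. \<omega> Xs)"
    by (intro zero_mean_gaussian_cong_AE[OF gaussian_law_sum_input[OF Z]]) measurable
  then show ?thesis by (rule zero_mean_gaussian_variance)
qed

lemma gaussian_laws_imp_gaussian_law:
  assumes "Z \<in> gaussian_laws c P1 P2 Ps"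
    and "zero_mean_gaussian Z u (\<lambda>\<omega>. \<omega> U)" "zero_mean_gaussian Z w (\<lambda>\<omega>. \<omega> W)"
  shows "gaussian_law c P1 P2 u w Z"
  using assms indep_vars_source_iff[of Z c]
  by (auto simp: gaussian_laws_def gaussian_law_def sources_def source_def source_var_def)

text \<open>Independence of \<open>U\<close> and \<open>W\<close> turns the constraint on the
  variance of \<open>Xs\<close> into \<open>u + w = Ps\<close>.\<close>

lemma gaussian_laws_iff:
  "Z \<in> gaussian_laws c P1 P2 Ps \<longleftrightarrow> (\<exists>u w. u + w = Ps \<and> gaussian_law c P1 P2 u w Z)"
proof
  assume Z: "Z \<in> gaussian_laws c P1 P2 Ps"
  then obtain u w where
    "zero_mean_gaussian Z u (\<lambda>\<omega>. \<omega> U)" "zero_mean_gaussian Z w (\<lambda>\<omega>. \<omega> W)"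
    by (auto simp: gaussian_laws_def)
  then have law: "gaussian_law c P1 P2 u w Z"
    using gaussian_laws_imp_gaussian_law[OF Z] by simp
  with gaussian_law_variance_Xs[OF law] Z show "\<exists>u w. u + w = Ps \<and> gaussian_law c P1 P2 u w Z"
    by (auto simp: gaussian_laws_def)
next
  assume "\<exists>u w. u + w = Ps \<and> gaussian_law c P1 P2 u w Z"
  then obtain u w where uw: "u + w = Ps" and Z: "gaussian_law c P1 P2 u w Z" by auto
  have "\<forall>v\<in>sources. zero_mean_gaussian Z (source_var c P1 P2 u w v) (source c v)" "prob_space Z"
    using Z by (auto simp: gaussian_law_def)
  then show "Z \<in> gaussian_laws c P1 P2 Ps"
    using Z indep_vars_source_iff[of Z c] gaussian_law_variance_Xs[OF Z] uw
    by (auto simp: gaussian_laws_def gaussian_law_def sources_def source_def source_var_def)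
qed

text \<open>The map \<open>h\<close> moves all of \<open>U + W\<close> into \<open>p\<close> and
  sets \<open>q\<close> to 0. It leaves \<open>Xs\<close>, \<open>X1\<close>, \<open>X2\<close> and
  the outputs alone, hence the noises too, and it preserves \<open>U + W\<close>.\<close>

lemma gaussian_law_merge:
  assumes Z: "gaussian_law c P1 P2 u w Z" and pq: "(p, q) \<in> {(U, W), (W, U)}"
  defines "h \<equiv> \<lambda>\<omega> v. if v = p then \<omega> U + \<omega> W else if v = q then 0 else \<omega> v :: real"
  shows "gaussian_law c P1 P2 (if p = U then u + w else 0) (if p = W then u + w else 0)
    (distr Z (\<Pi>\<^sub>M v\<in>UNIV. borel) h)" (is "gaussian_law c P1 P2 ?u ?w (distr Z ?N h)")
proof -
  interpret prob_space Z using Z by (simp add: gaussian_law_def)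
  have sets [measurable_cong]: "sets Z = sets (\<Pi>\<^sub>M v\<in>UNIV. borel)"
    and indep: "indep_vars (\<lambda>_. borel) (source c) sources"
    and gauss: "\<And>v. v \<in> sources \<Longrightarrow> zero_mean_gaussian Z (source_var c P1 P2 u w v) (source c v)"
    and Xs: "AE \<omega> in Z. \<omega> Xs = \<omega> U + \<omega> W"
    using Z by (auto simp: gaussian_law_def)
  have h_comp: "(\<lambda>\<omega>. h \<omega> v) \<in> borel_measurable Z" for v
    using pq by (cases v) (auto simp: h_def)
  have h [measurable]: "h \<in> measurable Z ?N"
    by (intro measurable_PiM_single') (use h_comp in \<open>auto simp: space_PiM\<close>)
  have source_h: "source c v (h \<omega>) = (if v = p then \<omega> U + \<omega> W else if v = q then 0 else source c v \<omega>)"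
    if "v \<in> sources" for v \<omega>
    using pq that by (auto simp: h_def source_def sources_def noise_p_def noise_s_def)
  \<comment> \<open>\<open>K v\<close> is the block of old sources that the new source
    \<open>v\<close> reads, empty for the constant 0. The blocks are disjoint, so independence
    survives; \<open>F\<close> computes the new source from its block.\<close>
  define K where "K v = (if v = p then {U, W} else if v = q then {} else {v})" for v
  have K: "indep_vars (\<lambda>v. PiM (K v) (\<lambda>_. borel)) (\<lambda>v \<omega>. restrict (\<lambda>i. source c i \<omega>) (K v)) sources"
    using pq by (intro indep_vars_restrict[OF indep])
      (auto simp: K_def sources_def disjoint_family_on_def)
  define F where "F v x = (if v = p then x U + x W else if v = q then 0 else x v)" for v and x :: "rv \<Rightarrow> real"
  have "F v \<in> borel_measurable (PiM (K v) (\<lambda>_. borel))" for v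
    using pq unfolding F_def[abs_def] K_def by auto
  with indep_vars_compose2[OF K, of F "\<lambda>_. borel"]
  have "indep_vars (\<lambda>_. borel) (\<lambda>v \<omega>. F v (restrict (\<lambda>i. source c i \<omega>) (K v))) sources"
    by simp
  moreover have "F v (restrict (\<lambda>i. source c i \<omega>) (K v)) = source c v (h \<omega>)" if "v \<in> sources" for v \<omega>
    using that pq by (auto simp: F_def K_def source_h) (auto simp: source_def)
  ultimately have "indep_vars (\<lambda>_. borel) (\<lambda>v \<omega>. source c v (h \<omega>)) sources"
    by (subst indep_vars_cong[OF refl _ refl, symmetric]) auto
  then have 1: "prob_space.indep_vars (distr Z ?N h) (\<lambda>_. borel) (source c) sources"
    by (intro indep_vars_distr) (auto simp: sources_def)
  have "zero_mean_gaussian Z (source_var c P1 P2 ?u ?w v) (\<lambda>\<omega>. source c v (h \<omega>))" if v: "v \<in> sources" for v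
  proof -
    consider "v = p" | "v = q" "v \<noteq> p" | "v \<noteq> p" "v \<noteq> q" by auto
    then show ?thesis
    proof cases
      case 1
      with v have "(\<lambda>\<omega>. source c v (h \<omega>)) = (\<lambda>\<omega>. \<omega> U + \<omega> W)"
        by (simp add: source_h)
      then show ?thesis
        using gaussian_law_sum_input[OF Z] 1 pq by (auto simp: source_var_def)
    next
      case 2
      with v have "(\<lambda>\<omega>. source c v (h \<omega>)) = (\<lambda>\<omega>. 0)"
        by (simp add: source_h)
      then show ?thesis
        using 2 pq by (auto simp: source_var_def zero_mean_gaussian_def)
    next
      case 3
      with v have "(\<lambda>\<omega>. source c v (h \<omega>)) = source c v"
        by (simp add: source_h)
      moreover have "source_var c P1 P2 ?u ?w v = source_var c P1 P2 u w v"
        using 3 pq by (auto simp: source_var_def split: rv.split)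
      ultimately show ?thesis
        using gauss[OF v] by simp
    qed
  qed
  then have 2: "\<forall>v\<in>sources. zero_mean_gaussian (distr Z ?N h) (source_var c P1 P2 ?u ?w v) (source c v)"
    by (simp add: zero_mean_gaussian_distr)
  have "AE \<omega> in Z. h \<omega> Xs = h \<omega> U + h \<omega> W"
    using Xs pq by (auto simp: h_def)
  then have 3: "AE \<omega> in distr Z ?N h. \<omega> Xs = \<omega> U + \<omega> W"
    by (subst AE_distr_iff) measurable
  show ?thesis
    unfolding gaussian_law_def using 1 2 3 prob_space_distr[OF h] by simp
qed

section \<open>Information between an output and the inputs\<close>

text \<open>The noise of \<open>y\<close> enters with gain 1 and that of the other output with gain
  0, so both outputs are sums over the same index set.\<close>

lemma output_eq_sum_sources:
  assumes c: "valid_channel c" and Z: "gaussian_law c P1 P2 u w Z" and y: "y \<in> {Yp, Ys}"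
  shows "AE \<omega> in Z. \<omega> y = (\<Sum>v\<in>sources. sqrt (gain c y v) * source c v \<omega>)"
proof -
  have "AE \<omega> in Z. \<omega> Xs = \<omega> U + \<omega> W"
    using Z by (simp add: gaussian_law_def)
  then show ?thesis
  proof eventually_elim
    case (elim \<omega>)
    then show ?case
      using y by (auto simp: sources_def source_def gain_def noise_p_def noise_s_def algebra_simps)
  qed
qed

text \<open>By independence this is the conditional variance of \<open>y\<close> given the inputs in
  \<open>A\<close>; for empty \<open>A\<close> it is the variance of \<open>y\<close>.\<close>

definition residual_var :: "channel \<Rightarrow> real \<Rightarrow> real \<Rightarrow> real \<Rightarrow> real \<Rightarrow> rv \<Rightarrow> rv set \<Rightarrow> real" where
  "residual_var c P1 P2 u w y A = (\<Sum>v\<in>sources - A. gain c y v * source_var c P1 P2 u w v)"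

context
  fixes b :: real and c :: channel and P1 P2 u w :: real and Z :: law and y :: rv
  assumes b: "b > 1" and c: "valid_channel c" and Z: "gaussian_law c P1 P2 u w Z"
    and y: "y \<in> {Yp, Ys}"
begin

interpretation prob_space Z
  using Z by (simp add: gaussian_law_def)

lemma gain_nonneg: "0 \<le> gain c y v"
  using c y by (cases v) (auto simp: gain_def valid_channel_def)

text \<open>The noise of \<open>y\<close> is never among the inputs in \<open>A\<close>, so its
  positive variance always remains in the sum.\<close>

lemma residual_var_pos:
  assumes A: "A \<subseteq> {U, W, X1, X2}"
  shows "residual_var c P1 P2 u w y A > 0"
proof -
  have "y \<in> sources - A" using y A by (auto simp: sources_def)
  then have "0 < gain c y y * source_var c P1 P2 u w y"
    using y c by (auto simp: gain_def source_var_def valid_channel_def)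
  moreover have "0 \<le> source_var c P1 P2 u w v" if "v \<in> sources" for v
    using Z that by (intro zero_mean_gaussian_nonneg) (auto simp: gaussian_law_def)
  ultimately show ?thesis
    unfolding residual_var_def using \<open>y \<in> sources - A\<close>
    by (intro sum_pos2[of _ y]) (auto intro!: mult_nonneg_nonneg gain_nonneg)
qed

text \<open>The map \<open>h\<close> lets one statement cover both a plain restriction to
  \<open>A\<close> and a pair of restrictions, as the chain rule requires; \<open>f\<close> recovers
  the contribution of \<open>A\<close> to the output from the value of \<open>h\<close>.\<close>

lemma mutual_information_output:
  assumes A: "A \<subseteq> {U, W, X1, X2}"
    and h [measurable]: "h \<in> measurable (\<Pi>\<^sub>M v\<in>A. borel) T" and f [measurable]: "f \<in> borel_measurable T"
    and f_h: "\<And>x. f (h x) = (\<Sum>v\<in>A. sqrt (gain c y v) * x v)"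
  shows "mutual_information b borel T (\<lambda>\<omega>. \<omega> y) (\<lambda>\<omega>. h (restrict \<omega> A)) =
    log b (residual_var c P1 P2 u w y {} / residual_var c P1 P2 u w y A) / 2"
proof -
  have sets [measurable_cong]: "sets Z = sets (\<Pi>\<^sub>M v\<in>UNIV. borel)"
    and indep: "indep_vars (\<lambda>_. borel) (source c) sources"
    and gauss: "\<And>v. v \<in> sources \<Longrightarrow> zero_mean_gaussian Z (source_var c P1 P2 u w v) (source c v)"
    using Z by (auto simp: gaussian_law_def)
  have AS: "A \<subseteq> sources" using A by (auto simp: sources_def)
  define V where "V = (\<lambda>\<omega>. \<Sum>v\<in>sources - A. sqrt (gain c y v) * source c v \<omega>)"
  define G where "G = (\<lambda>\<omega>. h (restrict \<omega> A))"
  \<comment> \<open>Used with \<open>B = A\<close> for the effective noise \<open>V\<close> and with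
    \<open>B = {}\<close> for the whole output.\<close>
  have part: "zero_mean_gaussian Z (residual_var c P1 P2 u w y B)
      (\<lambda>\<omega>. \<Sum>v\<in>sources - B. sqrt (gain c y v) * source c v \<omega>)" for B
    unfolding residual_var_def
  proof (rule zero_mean_gaussian_sum)
    show "indep_vars (\<lambda>_. borel) (\<lambda>v \<omega>. sqrt (gain c y v) * source c v \<omega>) (sources - B)"
      by (rule indep_vars_compose2[OF indep_vars_subset[OF indep]]) auto
    show "zero_mean_gaussian Z (gain c y v * source_var c P1 P2 u w v)
        (\<lambda>\<omega>. sqrt (gain c y v) * source c v \<omega>)" if "v \<in> sources - B" for v
      using zero_mean_gaussian_scale[OF gauss, of v "sqrt (gain c y v)"] that gain_nonneg by simp
  qed simp
  have source_eq: "source c v \<omega> = \<omega> v" if "v \<in> A" for v \<omega>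
    using that A by (auto simp: source_def)
  then have restr: "restrict (\<lambda>v. source c v \<omega>) A = restrict \<omega> A" for \<omega>
    by (auto simp: restrict_def)
  \<comment> \<open>\<open>V\<close> and \<open>G\<close> are functions of two disjoint blocks of
    independent sources; the product law of the blocks is pushed forward along \<open>s\<close> and
    \<open>h\<close>.\<close>
  have VG: "distr Z borel V \<Otimes>\<^sub>M distr Z T G = distr Z (borel \<Otimes>\<^sub>M T) (\<lambda>\<omega>. (V \<omega>, G \<omega>))"
  proof -
    let ?R = "\<lambda>B \<omega>. restrict (\<lambda>v. source c v \<omega>) B" and ?P = "\<lambda>B. \<Pi>\<^sub>M v\<in>B. borel"
    define s where "s = (\<lambda>x. \<Sum>v\<in>sources - A. sqrt (gain c y v) * x v)"
    have s [measurable]: "s \<in> borel_measurable (?P (sources - A))"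
      unfolding s_def by measurable
    have R [measurable]: "?R B \<in> measurable Z (?P B)" for B
      by (intro measurable_restrict) measurable
    have "indep_var (?P (sources - A)) (?R (sources - A)) (?P A) (?R A)"
      using AS by (intro indep_var_restrict[OF indep]) auto
    then have prod: "distr Z (?P (sources - A)) (?R (sources - A)) \<Otimes>\<^sub>M distr Z (?P A) (?R A) =
        distr Z (?P (sources - A) \<Otimes>\<^sub>M ?P A) (\<lambda>\<omega>. (?R (sources - A) \<omega>, ?R A \<omega>))"
      by (simp add: indep_var_distribution_eq)
    have V_s: "V = (\<lambda>\<omega>. s (?R (sources - A) \<omega>))" and G_h: "G = (\<lambda>\<omega>. h (?R A \<omega>))"
      unfolding V_def s_def G_def restr by (auto intro: ext sum.cong)
    have dV: "distr Z borel V = distr (distr Z (?P (sources - A)) (?R (sources - A))) borel s"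
      and dG: "distr Z T G = distr (distr Z (?P A) (?R A)) T h"
      by (auto simp: V_s G_h distr_distr comp_def)
    interpret GT: prob_space "distr (distr Z (?P A) (?R A)) T h"
      by (intro prob_space.prob_space_distr prob_space_distr) auto
    have "distr Z borel V \<Otimes>\<^sub>M distr Z T G =
        distr (distr Z (?P (sources - A)) (?R (sources - A)) \<Otimes>\<^sub>M distr Z (?P A) (?R A))
          (borel \<Otimes>\<^sub>M T) (\<lambda>(x, z). (s x, h z))"
      unfolding dV dG by (intro pair_measure_distr) (auto intro: GT.sigma_finite_measure_axioms)
    also have "\<dots> = distr Z (borel \<Otimes>\<^sub>M T) (\<lambda>\<omega>. (V \<omega>, G \<omega>))"
      unfolding prod by (subst distr_distr) (auto simp: comp_def V_s G_h)
    finally show ?thesis .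
  qed
  have [measurable]: "G \<in> measurable Z T"
  proof -
    have "(\<lambda>\<omega>. restrict (\<lambda>v. source c v \<omega>) A) \<in> measurable Z (\<Pi>\<^sub>M v\<in>A. borel)"
      by (intro measurable_restrict) measurable
    from measurable_compose[OF this h] show ?thesis by (simp add: G_def restr)
  qed
  have split: "(\<Sum>v\<in>sources. sqrt (gain c y v) * source c v \<omega>) = f (G \<omega>) + V \<omega>" for \<omega>
  proof -
    have "f (G \<omega>) = (\<Sum>v\<in>A. sqrt (gain c y v) * source c v \<omega>)"
      using source_eq by (simp add: G_def f_h)
    then show ?thesis
      unfolding V_def using sum.subset_diff[OF AS finite_sources, of "\<lambda>v. sqrt (gain c y v) * source c v \<omega>"] by simp
  qed
  have V: "zero_mean_gaussian Z (residual_var c P1 P2 u w y A) V"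
    unfolding V_def by (rule part)
  have Y: "zero_mean_gaussian Z (residual_var c P1 P2 u w y {}) (\<lambda>\<omega>. f (G \<omega>) + V \<omega>)"
    using part[of "{}"] by (simp add: split)
  note [measurable] = zero_mean_gaussian_measurable[OF Y]
  \<comment> \<open>The decomposition holds only almost surely, which suffices because mutual
    information depends on the laws alone.\<close>
  have ae: "AE \<omega> in Z. \<omega> y = f (G \<omega>) + V \<omega>"
    using output_eq_sum_sources[OF c Z y] by (simp add: split)
  have "distr Z borel (\<lambda>\<omega>. \<omega> y) = distr Z borel (\<lambda>\<omega>. f (G \<omega>) + V \<omega>)"
    using ae by (intro distr_cong_AE) auto
  moreover have "distr Z (borel \<Otimes>\<^sub>M T) (\<lambda>\<omega>. (\<omega> y, G \<omega>)) =
      distr Z (borel \<Otimes>\<^sub>M T) (\<lambda>\<omega>. (f (G \<omega>) + V \<omega>, G \<omega>))"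
    using ae by (intro distr_cong_AE) auto
  ultimately have "mutual_information b borel T (\<lambda>\<omega>. \<omega> y) G =
      mutual_information b borel T (\<lambda>\<omega>. f (G \<omega>) + V \<omega>) G"
    by (simp add: mutual_information_def)
  also have "\<dots> = log b (residual_var c P1 P2 u w y {} / residual_var c P1 P2 u w y A) / 2"
    using A by (intro mutual_information_additive_gaussian[where f = f] b VG f V Y residual_var_pos) auto
  finally show ?thesis by (simp add: G_def)
qed

lemma mi_output:
  assumes A: "A \<subseteq> {U, W, X1, X2}"
  shows "mi b Z y A = log b (residual_var c P1 P2 u w y {} / residual_var c P1 P2 u w y A) / 2"
  unfolding mi_def
  by (rule mutual_information_output[OF A, where h="\<lambda>x. x" and f="\<lambda>x. \<Sum>v\<in>A. sqrt (gain c y v) * x v"])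
     auto

text \<open>In the difference of the informations about \<open>A\<close> with \<open>C\<close> and
  about \<open>C\<close> alone, the variance of \<open>y\<close> cancels.\<close>

lemma cmi_output:
  assumes AC: "A \<union> C \<subseteq> {U, W, X1, X2}" and disj: "A \<inter> C = {}"
  shows "cmi b Z y A C = log b (residual_var c P1 P2 u w y C / residual_var c P1 P2 u w y (A \<union> C)) / 2"
proof -
  have fin: "finite A" "finite C"
    using AC by (auto intro: finite_subset)
  have sum_restrict: "(\<Sum>v\<in>B. k v * restrict x B v) = (\<Sum>v\<in>B. k v * x v)"
    for B and k x :: "rv \<Rightarrow> real"
    by (intro sum.cong) auto
  have "mutual_information b borel ((\<Pi>\<^sub>M v\<in>A. borel) \<Otimes>\<^sub>M (\<Pi>\<^sub>M v\<in>C. borel)) (\<lambda>\<omega>. \<omega> y)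
      (\<lambda>\<omega>. (\<lambda>x. (restrict x A, restrict x C)) (restrict \<omega> (A \<union> C))) =
    log b (residual_var c P1 P2 u w y {} / residual_var c P1 P2 u w y (A \<union> C)) / 2"
  proof (rule mutual_information_output[OF AC])
    show "(\<lambda>x. (restrict x A, restrict x C)) \<in>
        (\<Pi>\<^sub>M v\<in>A \<union> C. borel) \<rightarrow>\<^sub>M (\<Pi>\<^sub>M v\<in>A. borel) \<Otimes>\<^sub>M (\<Pi>\<^sub>M v\<in>C. borel)"
      by (intro measurable_Pair measurable_restrict_subset) auto
    show "(\<lambda>p. (\<Sum>v\<in>A. sqrt (gain c y v) * fst p v) + (\<Sum>v\<in>C. sqrt (gain c y v) * snd p v))
        \<in> borel_measurable ((\<Pi>\<^sub>M v\<in>A. borel) \<Otimes>\<^sub>M (\<Pi>\<^sub>M v\<in>C. borel))"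
      by measurable
    show "(\<Sum>v\<in>A. sqrt (gain c y v) * fst (restrict x A, restrict x C) v) +
        (\<Sum>v\<in>C. sqrt (gain c y v) * snd (restrict x A, restrict x C) v) =
        (\<Sum>v\<in>A \<union> C. sqrt (gain c y v) * x v)" for x
      unfolding fst_conv snd_conv sum_restrict using fin disj by (simp add: sum.union_disjoint)
  qed
  moreover have "restrict (restrict \<omega> (A \<union> C)) A = restrict \<omega> A"
    "restrict (restrict \<omega> (A \<union> C)) C = restrict \<omega> C" for \<omega> :: "rv \<Rightarrow> real"
    by (auto simp: restrict_def)
  ultimately have "cmi b Z y A C =
      log b (residual_var c P1 P2 u w y {} / residual_var c P1 P2 u w y (A \<union> C)) / 2 - mi b Z y C"
    by (simp add: cmi_def conditional_mutual_information_def mi_def)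
  then show ?thesis
    using AC b residual_var_pos[of "{}"] residual_var_pos[of C] residual_var_pos[of "A \<union> C"]
    by (simp add: mi_output log_divide diff_divide_distrib)
qed

end

subsection \<open>Rate regions\<close>

text \<open>At \<open>Yp\<close> the signal \<open>U\<close> always acts as noise, whence the common
  denominator \<open>gsp c * u + n\<close>. At \<open>Ys\<close> the inputs \<open>X1\<close> and
  \<open>X2\<close> act as noise, and \<open>d\<close> is their received power plus
  \<open>N0 c\<close>.\<close>

lemma gaussian_informations:
  fixes b :: real
  assumes b: "b > 1" and c: "valid_channel c" and Z: "gaussian_law c P1 P2 u w Z"
  defines "p1 \<equiv> g1p c * P1" and "p2 \<equiv> g2p c * P2" and "n \<equiv> N0 c"
    and "d \<equiv> g1s c * P1 + g2s c * P2 + N0 c"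
  shows "cmi b Z Yp {X1} {W, X2} = log b ((p1 + gsp c * u + n) / (gsp c * u + n)) / 2"
    and "cmi b Z Yp {X2} {W, X1} = log b ((p2 + gsp c * u + n) / (gsp c * u + n)) / 2"
    and "cmi b Z Yp {W} {X1, X2} = log b ((gsp c * (u + w) + n) / (gsp c * u + n)) / 2"
    and "cmi b Z Yp {X1, X2} {W} = log b ((p1 + p2 + gsp c * u + n) / (gsp c * u + n)) / 2"
    and "cmi b Z Yp {W, X1} {X2} = log b ((p1 + gsp c * (u + w) + n) / (gsp c * u + n)) / 2"
    and "cmi b Z Yp {W, X2} {X1} = log b ((p2 + gsp c * (u + w) + n) / (gsp c * u + n)) / 2"
    and "mi b Z Yp {W, X1, X2} = log b ((p1 + p2 + gsp c * (u + w) + n) / (gsp c * u + n)) / 2"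
    and "cmi b Z Ys {U} {W} = log b ((gss c * u + d) / d) / 2"
    and "cmi b Z Ys {W} {U} = log b ((gss c * w + d) / d) / 2"
    and "mi b Z Ys {U, W} = log b ((gss c * (u + w) + d) / d) / 2"
    and "mi b Z Ys {W} = log b ((gss c * (u + w) + d) / (gss c * u + d)) / 2"
  unfolding p1_def p2_def n_def d_def
  by (simp_all add: cmi_output[OF b c Z] mi_output[OF b c Z] residual_var_def sources_def
      insert_Diff_if gain_def source_var_def algebra_simps)

text \<open>The two products under the logarithms differ by \<open>x * y\<close>.\<close>

lemma log_submodular:
  fixes b x y n :: real
  assumes "b > 1" "x \<ge> 0" "y \<ge> 0" "n > 0"
  shows "log b (x + y + n) + log b n \<le> log b (x + n) + log b (y + n)"
proof -
  have "(x + y + n) * n \<le> (x + n) * (y + n)"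
    using assms by (simp add: algebra_simps)
  then have "log b ((x + y + n) * n) \<le> log b ((x + n) * (y + n))"
    using assms by (intro log_mono mult_pos_pos add_nonneg_pos add_nonneg_nonneg)
  moreover have "x + y + n \<noteq> 0" "x + n \<noteq> 0" "y + n \<noteq> 0" "n \<noteq> 0"
    using assms by auto
  ultimately show ?thesis
    by (simp add: log_mult)
qed

text \<open>After cross-multiplication the power \<open>p\<close> cancels, so the comparison has the
  same outcome at every positive power.\<close>

lemma log_snr_le_iff:
  fixes b s t n d p :: real
  assumes "b > 1" "p > 0" "n > 0" "d > 0" "s > 0" "t > 0"
  shows "log b (s * p + d) - log b d \<le> log b (t * p + n) - log b n \<longleftrightarrow> s * n \<le> t * d"
proof -
  have "s * p + d \<noteq> 0" "t * p + n \<noteq> 0" "d \<noteq> 0" "n \<noteq> 0"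
    using assms by (auto simp: add_pos_pos less_imp_neq[symmetric])
  then have "log b (s * p + d) - log b d \<le> log b (t * p + n) - log b n \<longleftrightarrow>
      log b ((s * p + d) * n) \<le> log b ((t * p + n) * d)"
    by (auto simp: log_mult)
  also have "\<dots> \<longleftrightarrow> (s * p + d) * n \<le> (t * p + n) * d"
    using assms by (intro log_le_cancel_iff) (auto intro!: mult_pos_pos add_pos_pos)
  also have "\<dots> \<longleftrightarrow> p * (s * n) \<le> p * (t * d)"
    by (simp add: algebra_simps)
  finally show ?thesis using assms by simp
qed

section \<open>Inclusions between the regions for different power splits\<close>

text \<open>Here \<open>p1\<close> and \<open>p2\<close> are the received powers of
  \<open>X1\<close> and \<open>X2\<close> at \<open>Yp\<close>, \<open>t\<close> and
  \<open>s\<close> the gains of \<open>Xs\<close> at \<open>Yp\<close> and \<open>Ys\<close>, and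
  \<open>n\<close> and \<open>d\<close> the respective noise levels, \<open>d\<close> including the
  interference.\<close>

locale gaussian_rates =
  fixes b p1 p2 t s n d :: real
  assumes b: "b > 1" and pos: "p1 > 0" "p2 > 0" "t > 0" "s > 0" "n > 0" "d > 0"
begin

definition region :: "real \<Rightarrow> real \<Rightarrow> (real \<times> real) set" where
  "region u w = {(S + T, R1 + R2) | S T R1 R2.
     0 \<le> R1 \<and> 0 \<le> R2 \<and> 0 \<le> S \<and> 0 \<le> T \<and>
     R1 \<le> log b ((p1 + t * u + n) / (t * u + n)) / 2 \<and>
     R2 \<le> log b ((p2 + t * u + n) / (t * u + n)) / 2 \<and>
     T \<le> log b ((t * (u + w) + n) / (t * u + n)) / 2 \<and>
     R1 + R2 \<le> log b ((p1 + p2 + t * u + n) / (t * u + n)) / 2 \<and>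
     T + R1 \<le> log b ((p1 + t * (u + w) + n) / (t * u + n)) / 2 \<and>
     T + R2 \<le> log b ((p2 + t * (u + w) + n) / (t * u + n)) / 2 \<and>
     T + R1 + R2 \<le> log b ((p1 + p2 + t * (u + w) + n) / (t * u + n)) / 2 \<and>
     S \<le> log b ((s * u + d) / d) / 2 \<and>
     T \<le> log b ((s * w + d) / d) / 2 \<and>
     S + T \<le> log b ((s * (u + w) + d) / d) / 2}"

lemma log_quotient: "x > 0 \<Longrightarrow> y > 0 \<Longrightarrow> log b (x / y) = log b x - log b y"
  using b by (simp add: log_divide)

text \<open>Without \<open>U\<close> the bounds at \<open>Yp\<close> form a polymatroid, so eliminating \<open>R1\<close> and \<open>R2\<close> leaves only
  the bounds on \<open>T\<close>, \<open>R1 + R2\<close> and \<open>T + R1 + R2\<close>.\<close>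

lemma region_common:
  assumes w: "w \<ge> 0"
  shows "region 0 w = {(x, y). 0 \<le> x \<and> 0 \<le> y \<and>
     x \<le> log b ((t * w + n) / n) / 2 \<and> x \<le> log b ((s * w + d) / d) / 2 \<and>
     y \<le> log b ((p1 + p2 + n) / n) / 2 \<and>
     x + y \<le> log b ((p1 + p2 + t * w + n) / n) / 2}" (is "_ = ?R")
proof (intro equalityI subsetI)
  fix z assume "z \<in> region 0 w"
  then show "z \<in> ?R"
    using pos by (auto simp: region_def)
next
  fix z assume "z \<in> ?R"
  then obtain x y where z: "z = (x, y)" and xy: "0 \<le> x" "0 \<le> y"
    "x \<le> log b ((t * w + n) / n) / 2" "x \<le> log b ((s * w + d) / d) / 2"
    "y \<le> log b ((p1 + p2 + n) / n) / 2" "x + y \<le> log b ((p1 + p2 + t * w + n) / n) / 2"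
    by auto
  have tw: "0 \<le> t * w" and sw: "0 \<le> s * w" using w pos by auto
  have quot: "log b ((p1 + n) / n) = log b (p1 + n) - log b n"
    "log b ((p2 + n) / n) = log b (p2 + n) - log b n"
    "log b ((t * w + n) / n) = log b (t * w + n) - log b n"
    "log b ((p1 + p2 + n) / n) = log b (p1 + p2 + n) - log b n"
    "log b ((p1 + t * w + n) / n) = log b (p1 + t * w + n) - log b n"
    "log b ((p2 + t * w + n) / n) = log b (p2 + t * w + n) - log b n"
    "log b ((p1 + p2 + t * w + n) / n) = log b (p1 + p2 + t * w + n) - log b n"
    using pos tw by (auto intro!: log_quotient add_pos_nonneg add_nonneg_pos)
  have mono: "log b n \<le> log b (p1 + n)" "log b n \<le> log b (p2 + n)"
    "log b (t * w + n) \<le> log b (p1 + t * w + n)" "log b (t * w + n) \<le> log b (p2 + t * w + n)"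
    using b pos tw by (auto intro!: log_mono)
  have sub: "log b (p1 + p2 + n) + log b n \<le> log b (p1 + n) + log b (p2 + n)"
    "log b (p1 + p2 + t * w + n) + log b n \<le> log b (p1 + n) + log b (p2 + t * w + n)"
    "log b (p1 + p2 + t * w + n) + log b n \<le> log b (p1 + t * w + n) + log b (p2 + n)"
    "log b (p1 + p2 + t * w + n) + log b (t * w + n) \<le> log b (p1 + t * w + n) + log b (p2 + t * w + n)"
    using log_submodular[OF b, of p1 p2 n] log_submodular[OF b, of p1 "p2 + t * w" n]
      log_submodular[OF b, of "p1 + t * w" p2 n] log_submodular[OF b, of p1 p2 "t * w + n"] pos tw
    by (simp_all add: algebra_simps)
  \<comment> \<open>The largest value allowed by \<open>y\<close> and the two upper bounds on
    \<open>R1\<close>. If the minimum is \<open>y\<close>, the bounds on \<open>y - R1\<close>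
    follow from \<open>xy\<close> and \<open>mono\<close>; otherwise each follows from one
    inequality of \<open>sub\<close>, the last of them serving when \<open>x\<close> is counted
    twice.\<close>
  define R1 where "R1 = min y (min (log b ((p1 + n) / n) / 2) (log b ((p1 + t * w + n) / n) / 2 - x))"
  have "0 \<le> R1 \<and> 0 \<le> y - R1 \<and>
      R1 \<le> log b ((p1 + n) / n) / 2 \<and> y - R1 \<le> log b ((p2 + n) / n) / 2 \<and>
      x + R1 \<le> log b ((p1 + t * w + n) / n) / 2 \<and>
      x + (y - R1) \<le> log b ((p2 + t * w + n) / n) / 2"
    using xy sub mono unfolding R1_def quot by (auto simp: min_def field_simps)
  \<comment> \<open>With \<open>u = 0\<close> the bound on \<open>S\<close> is 0, so all of
    \<open>x\<close> must be carried by \<open>T\<close>.\<close>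
  then show "z \<in> region 0 w"
    unfolding region_def z using xy pos
    by (intro CollectI exI[of _ 0] exI[of _ x] exI[of _ R1] exI[of _ "y - R1"]) auto
qed

text \<open>After elimination only weak inequalities between continuous functions remain. Closedness
  lets this region absorb the closure in \<open>gaussian_rate_region\<close>.\<close>

lemma closed_region_common:
  assumes w: "w \<ge> 0"
  shows "closed (region 0 w)"
  unfolding region_common[OF w] split_def
  by (intro closed_Collect_conj closed_Collect_le continuous_intros)

lemma region_subset_common:
  assumes u: "u \<ge> 0" and w: "w \<ge> 0" and snr: "s * n \<le> t * d"
  shows "region u w \<subseteq> region 0 (u + w)"
proof
  fix z assume "z \<in> region u w"
  then obtain S T R1 R2 where z: "z = (S + T, R1 + R2)"
    and nonneg: "0 \<le> R1" "0 \<le> R2" "0 \<le> S" "0 \<le> T"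
    and R12: "R1 + R2 \<le> log b ((p1 + p2 + t * u + n) / (t * u + n)) / 2"
    and TR12: "T + R1 + R2 \<le> log b ((p1 + p2 + t * (u + w) + n) / (t * u + n)) / 2"
    and S: "S \<le> log b ((s * u + d) / d) / 2"
    and ST: "S + T \<le> log b ((s * (u + w) + d) / d) / 2"
    unfolding region_def by blast
  have nn: "0 \<le> t * u" "0 \<le> s * u" "0 \<le> t * (u + w)" "0 \<le> s * (u + w)"
    using u w pos by auto
  have quot: "log b ((p1 + p2 + t * u + n) / (t * u + n)) = log b (p1 + p2 + t * u + n) - log b (t * u + n)"
    "log b ((p1 + p2 + t * (u + w) + n) / (t * u + n)) = log b (p1 + p2 + t * (u + w) + n) - log b (t * u + n)"
    "log b ((p1 + p2 + t * (u + w) + n) / n) = log b (p1 + p2 + t * (u + w) + n) - log b n"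
    "log b ((p1 + p2 + n) / n) = log b (p1 + p2 + n) - log b n"
    "log b ((t * (u + w) + n) / n) = log b (t * (u + w) + n) - log b n"
    "log b ((s * u + d) / d) = log b (s * u + d) - log b d"
    "log b ((s * (u + w) + d) / d) = log b (s * (u + w) + d) - log b d"
    using pos nn by (auto intro!: log_quotient add_nonneg_pos)
  \<comment> \<open>Zero power is treated separately, both sides being 0; it occurs for
    \<open>u = 0\<close>.\<close>
  have snr_le: "log b (s * p + d) - log b d \<le> log b (t * p + n) - log b n" if "p \<ge> 0" for p
    using that log_snr_le_iff[OF b, of p n d s t] snr pos by (cases "p = 0") auto
  \<comment> \<open>Raising the noise level from \<open>n\<close> to \<open>t * u + n\<close> can
    only lower the bound on \<open>R1 + R2\<close>.\<close>
  have "log b (p1 + p2 + t * u + n) + log b n \<le> log b (p1 + p2 + n) + log b (t * u + n)"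
    using log_submodular[OF b, of "p1 + p2" "t * u" n] pos nn by simp
  then have "R1 + R2 \<le> log b ((p1 + p2 + n) / n) / 2"
    using R12 unfolding quot by simp
  \<comment> \<open>By \<open>snr_le\<close> the bound on \<open>S\<close> is at most half of
    \<open>log b (t * u + n) - log b n\<close>, exactly the gap between the denominators
    \<open>t * u + n\<close> in \<open>TR12\<close> and \<open>n\<close> here.\<close>
  moreover have "S + T + (R1 + R2) \<le> log b ((p1 + p2 + t * (u + w) + n) / n) / 2"
    using S TR12 snr_le[OF u] unfolding quot by simp
  moreover have "S + T \<le> log b ((t * (u + w) + n) / n) / 2"
    using ST snr_le[of "u + w"] u w unfolding quot by simp
  ultimately show "z \<in> region 0 (u + w)"
    using nonneg ST u w by (simp add: region_common z)
qed

lemma region_common_not_subset: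
  assumes u: "u > 0" and w: "w \<ge> 0"
  shows "\<not> region 0 (u + w) \<subseteq> region u w"
proof
  assume sub: "region 0 (u + w) \<subseteq> region u w"
  have tu: "0 < t * u" and tuw: "0 < t * (u + w)" and suw: "0 < s * (u + w)"
    using u w pos by auto
  \<comment> \<open>The separating point: no rate for \<open>Xs\<close>, and the full sum rate of
    \<open>X1\<close> and \<open>X2\<close> against noise \<open>n\<close> alone.\<close>
  have "(0, log b ((p1 + p2 + n) / n) / 2) \<in> region 0 (u + w)"
    using u w pos b tuw suw by (auto simp: region_common zero_le_log_cancel_iff field_simps intro!: log_mono)
  with sub have "(0, log b ((p1 + p2 + n) / n) / 2) \<in> region u w" ..
  moreover have "y \<le> log b ((p1 + p2 + t * u + n) / (t * u + n)) / 2" if "(x, y) \<in> region u w" for x y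
    using that by (auto simp: region_def)
  ultimately have "log b ((p1 + p2 + n) / n) \<le> log b ((p1 + p2 + t * u + n) / (t * u + n))"
    by fastforce
  then have "(p1 + p2 + n) / n \<le> (p1 + p2 + t * u + n) / (t * u + n)"
    using pos b tu by (subst (asm) log_le_cancel_iff) auto
  then have "(p1 + p2) * (t * u) \<le> 0"
    using pos tu by (simp add: field_simps)
  moreover have "(p1 + p2) * (t * u) > 0"
    using pos tu by simp
  ultimately show False by simp
qed

lemma region_private_not_subset:
  assumes w: "w > 0" and snr: "\<not> s * n \<le> t * d"
  shows "\<not> region w 0 \<subseteq> region 0 w"
proof
  assume sub: "region w 0 \<subseteq> region 0 w"
  have tw: "0 < t * w" and sw: "0 < s * w" using w pos by auto
  \<comment> \<open>All rate is put into \<open>S\<close>, with \<open>T = R1 = R2 = 0\<close>, so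
    only the bounds at \<open>Ys\<close> limit it. In \<open>region 0 w\<close> the first coordinate
    is also bounded through \<open>Yp\<close>.\<close>
  have "(log b ((s * w + d) / d) / 2, 0) \<in> region w 0"
    unfolding region_def using pos b tw sw
    by (intro CollectI exI[of _ "log b ((s * w + d) / d) / 2"] exI[of _ 0])
       (auto simp: zero_le_log_cancel_iff)
  with sub have "log b ((s * w + d) / d) \<le> log b ((t * w + n) / n)"
    using w by (auto simp: region_common)
  then have "log b (s * w + d) - log b d \<le> log b (t * w + n) - log b n"
    using pos tw sw by (simp add: log_quotient)
  with snr show False
    using log_snr_le_iff[OF b w] pos by simp
qed

end

section \<open>Return from the numerical regions to channel laws\<close>

lemma rate_region_gaussian:
  assumes b: "b > 1" and c: "valid_channel c" and Z: "gaussian_law c P1 P2 u w Z"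
    and P: "P1 > 0" "P2 > 0"
  shows "rate_region b Z = gaussian_rates.region b (g1p c * P1) (g2p c * P2) (gsp c) (gss c) (N0 c)
    (g1s c * P1 + g2s c * P2 + N0 c) u w"
proof -
  interpret gaussian_rates b "g1p c * P1" "g2p c * P2" "gsp c" "gss c" "N0 c"
    "g1s c * P1 + g2s c * P2 + N0 c"
    using b c P by unfold_locales (auto simp: valid_channel_def add_pos_pos)
  show ?thesis
    unfolding rate_region_def region_def gaussian_informations[OF b c Z] ..
qed

theorem theorem7:
  fixes b :: real and c :: channel and P1 P2 Ps lam :: real and Z :: law
  assumes "b > 1"
    and "valid_channel c"
    and "P1 > 0" and "P2 > 0" and "Ps > 0"
    and "0 \<le> lam" and "lam \<le> 1"
    and "Z \<in> gaussian_laws c P1 P2 Ps"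
    and "zero_mean_gaussian Z (lam * Ps) (\<lambda>\<omega>. \<omega> U)"
    and "zero_mean_gaussian Z ((1 - lam) * Ps) (\<lambda>\<omega>. \<omega> W)"
  shows "(rate_region b Z = gaussian_rate_region b c P1 P2 Ps \<longleftrightarrow>
            lam = 0 \<and> mi b Z Ys {W} \<le> cmi b Z Yp {W} {X1, X2})
       \<and> (lam = 0 \<longrightarrow>
            (mi b Z Ys {W} \<le> cmi b Z Yp {W} {X1, X2} \<longleftrightarrow>
             gss c * N0 c \<le> gsp c * (g1s c * P1 + g2s c * P2 + N0 c)))"
proof -
  let ?d = "g1s c * P1 + g2s c * P2 + N0 c"
  interpret gaussian_rates b "g1p c * P1" "g2p c * P2" "gsp c" "gss c" "N0 c" ?d
    using assms by unfold_locales (auto simp: valid_channel_def add_pos_pos)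
  let ?u = "lam * Ps" and ?w = "(1 - lam) * Ps"
  have uw: "?u \<ge> 0" "?w \<ge> 0" "?u + ?w = Ps"
    using assms by (auto simp: algebra_simps)
  have Z: "gaussian_law c P1 P2 ?u ?w Z"
    using assms by (intro gaussian_laws_imp_gaussian_law)
  have rates: "rate_region b Z' = region u w" if "gaussian_law c P1 P2 u w Z'" for u w Z'
    using rate_region_gaussian[OF \<open>b > 1\<close> \<open>valid_channel c\<close> that] assms by simp
  have Z_eq: "rate_region b Z = region ?u ?w"
    by (rule rates[OF Z])
  have "gaussian_law c P1 P2 Ps 0 Z' \<Longrightarrow> Z' \<in> gaussian_laws c P1 P2 Ps"
    "gaussian_law c P1 P2 0 Ps Z' \<Longrightarrow> Z' \<in> gaussian_laws c P1 P2 Ps" for Z'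
    unfolding gaussian_laws_iff by force+
  \<comment> \<open>Merging into \<open>U\<close> gives the law for \<open>lam = 1\<close>, merging
    into \<open>W\<close> the one for \<open>lam = 0\<close>.\<close>
  moreover obtain Z1 Z0 where "gaussian_law c P1 P2 Ps 0 Z1" "gaussian_law c P1 P2 0 Ps Z0"
    using gaussian_law_merge[OF Z, of U W] gaussian_law_merge[OF Z, of W U] uw(3) by simp
  ultimately have "\<exists>Z'\<in>gaussian_laws c P1 P2 Ps. rate_region b Z' = region Ps 0"
    "\<exists>Z'\<in>gaussian_laws c P1 P2 Ps. rate_region b Z' = region 0 Ps"
    using rates by blast+
  then have extremes: "region Ps 0 \<subseteq> gaussian_rate_region b c P1 P2 Ps"
    "region 0 Ps \<subseteq> gaussian_rate_region b c P1 P2 Ps"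
    unfolding gaussian_rate_region_def using closure_subset by blast+
  have equiv: "mi b Z Ys {W} \<le> cmi b Z Yp {W} {X1, X2} \<longleftrightarrow> gss c * N0 c \<le> gsp c * ?d" if "lam = 0"
  proof -
    have "mi b Z Ys {W} = (log b (gss c * Ps + ?d) - log b ?d) / 2"
      "cmi b Z Yp {W} {X1, X2} = (log b (gsp c * Ps + N0 c) - log b (N0 c)) / 2"
      using that pos \<open>Ps > 0\<close>
      by (simp_all add: gaussian_informations[OF \<open>b > 1\<close> \<open>valid_channel c\<close> Z] log_quotient add_pos_pos)
    then show ?thesis
      using log_snr_le_iff[OF b \<open>Ps > 0\<close>, of "N0 c" ?d "gss c" "gsp c"] pos by auto
  qed
  have "rate_region b Z = gaussian_rate_region b c P1 P2 Ps \<longleftrightarrow>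
    lam = 0 \<and> gss c * N0 c \<le> gsp c * ?d"
  proof
    assume eq: "rate_region b Z = gaussian_rate_region b c P1 P2 Ps"
    \<comment> \<open>For positive \<open>lam\<close> equality would place
      \<open>region 0 Ps\<close> inside the smaller region of \<open>Z\<close>.\<close>
    have lam: "lam = 0"
    proof (rule ccontr)
      assume "lam \<noteq> 0"
      with assms have "?u > 0" by simp
      from region_common_not_subset[OF this uw(2)] extremes eq Z_eq uw(3) show False by simp
    qed
    \<comment> \<open>Now \<open>Z\<close> has region \<open>region 0 Ps\<close>, which by equality
      contains \<open>region Ps 0\<close>; this forces the inequality.\<close>
    with region_private_not_subset[OF \<open>Ps > 0\<close>] extremes eq Z_eq
    show "lam = 0 \<and> gss c * N0 c \<le> gsp c * ?d" by auto
  next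
    assume *: "lam = 0 \<and> gss c * N0 c \<le> gsp c * ?d"
    \<comment> \<open>The union lies in the closed set \<open>region 0 Ps\<close>, hence so does its
      closure; \<open>extremes\<close> gives the reverse inclusion.\<close>
    have "rate_region b Z' \<subseteq> region 0 Ps" if "Z' \<in> gaussian_laws c P1 P2 Ps" for Z'
    proof -
      from that obtain u w where u_w: "u + w = Ps" and Z': "gaussian_law c P1 P2 u w Z'"
        by (auto simp: gaussian_laws_iff)
      then have "zero_mean_gaussian Z' u (source c U)" "zero_mean_gaussian Z' w (source c W)"
        by (auto simp: gaussian_law_def sources_def source_var_def)
      then have "u \<ge> 0" "w \<ge> 0"
        by (auto intro: zero_mean_gaussian_nonneg)
      from region_subset_common[OF this] * u_w rates[OF Z'] show ?thesis by simp
    qed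
    then have "gaussian_rate_region b c P1 P2 Ps \<subseteq> region 0 Ps"
      unfolding gaussian_rate_region_def using closed_region_common[of Ps] \<open>Ps > 0\<close>
      by (intro closure_minimal) auto
    with extremes * Z_eq show "rate_region b Z = gaussian_rate_region b c P1 P2 Ps" by auto
  qed
  with equiv show ?thesis by blast
qed

end
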